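(* Let $\kappa$ be a cardinal, let $X$ be a set, and suppose that $c:[X]^2\to\kappa$ is odd-cycle-free. Then $c$ is isomorphic to a $\delta$-colouring; that is, there is an injective function $\iota:X\to 2^\kappa$ such that the function $c':[\iota``X]^2\to\kappa$ defined by $c'(\iota(x),\iota(y))=c(x,y)$ (for distinct $x,y\in X$) is a $\delta$-colouring.
   Context: $2^\kappa$ denotes the set of all functions from $\kappa$ to $2=\{0,1\}$; $[X]^2$ is the set of two-element subsets of $X$; $c(x,y)$ abbreviates $c(\{x,y\})$; $\iota``X$ is the image of $X$ under $\iota$. A colouring $c:[X]^2\to\kappa$ is odd-cycle-free if there is no injective sequence $\langle x_i\mid i<k\rangle$ of elements of $X$, with $k\geq 3$ odd, such that $c$ is constant on $\{\{x_i,x_{i+1}\}\mid i+1<k\}\cup\{\{x_{k-1},x_0\}\}$. If $Z\subseteq 2^\kappa$, a colouring $d:[Z]^2\to\kappa$ is a $\delta$-colouring if $x(d(x,y))\neq y(d(x,y))$ for all distinct $x,y\in Z$. *)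

theory Defs
  imports "HOL-Library.Ramsey" "HOL-Library.FuncSet"
begin

text \<open>
  A cardinal \<open>\<kappa>\<close> is a cardinal order in the sense of the library, that is, a relation with
  \<open>Card_order \<kappa>\<close>; its elements (the ordinals below \<open>\<kappa>\<close>) are the elements of \<open>Field \<kappa>\<close>.
\<close>

text \<open>
  A set of functions on \<open>\<kappa>\<close> has to consist of extensional functions, so that distinct elements
  differ at some point of \<open>\<kappa>\<close>; hence \<open>PiE\<close> rather than \<open>Pi\<close>.
\<close>

definition two_power :: "'k rel \<Rightarrow> ('k \<Rightarrow> nat) set" where
  "two_power \<kappa> = Field \<kappa> \<rightarrow>\<^sub>E {0, 1}"

text \<open>
  A function on \<open>[X]\<^sup>2\<close> is represented by a function on all sets, whose values outside
  \<open>nsets X 2\<close> are irrelevant.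
\<close>

definition colouring :: "'a set \<Rightarrow> 'k rel \<Rightarrow> ('a set \<Rightarrow> 'k) \<Rightarrow> bool" where
  "colouring X \<kappa> c \<longleftrightarrow> c \<in> nsets X 2 \<rightarrow> Field \<kappa>"

definition cycle_edges :: "nat \<Rightarrow> (nat \<Rightarrow> 'a) \<Rightarrow> 'a set set" where
  "cycle_edges k x = {{x i, x (i + 1)} | i. i + 1 < k} \<union> {{x (k - 1), x 0}}"

definition odd_cycle_free :: "'a set \<Rightarrow> ('a set \<Rightarrow> 'k) \<Rightarrow> bool" where
  "odd_cycle_free X c \<longleftrightarrow>
    \<not> (\<exists>k x. k \<ge> 3 \<and> odd k \<and> x \<in> {..<k} \<rightarrow> X \<and> inj_on x {..<k} \<and>
           (\<exists>\<alpha>. \<forall>e\<in>cycle_edges k x. c e = \<alpha>))"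

definition delta_colouring :: "'k rel \<Rightarrow> ('k \<Rightarrow> nat) set \<Rightarrow> (('k \<Rightarrow> nat) set \<Rightarrow> 'k) \<Rightarrow> bool" where
  "delta_colouring \<kappa> Z d \<longleftrightarrow>
    Z \<subseteq> two_power \<kappa> \<and> colouring Z \<kappa> d \<and>
    (\<forall>x\<in>Z. \<forall>y\<in>Z. x \<noteq> y \<longrightarrow> x (d {x, y}) \<noteq> y (d {x, y}))"

end

theory Submission
  imports Defs
begin

text \<open>
  For each colour \<open>\<alpha>\<close>, the pairs of colour \<open>\<alpha>\<close> form a graph without odd cycles, hence
  a bipartite one. The bipartition chosen for \<open>\<alpha>\<close> supplies the coordinate \<open>\<alpha>\<close> of \<open>\<iota>\<close>,
  so that \<open>\<iota> x\<close> and \<open>\<iota> y\<close> differ at \<open>c {x, y}\<close>; in particular \<open>\<iota>\<close> is injective.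
\<close>

text \<open>
  A repeated vertex cuts a closed walk into two shorter closed walks, one of which is again odd.
\<close>

lemma odd_closed_walk_contains_odd_cycle:
  assumes "irrefl E" and "odd k" and "(a, a) \<in> E ^^ k"
  obtains m w where "m \<ge> 3" "odd m" "inj_on w {..<m}" "w m = w 0" "\<forall>i<m. (w i, w (Suc i)) \<in> E"
proof -
  have "\<exists>m w. m \<ge> 3 \<and> odd m \<and> inj_on w {..<m} \<and> w m = w 0 \<and> (\<forall>i<m. (w i, w (Suc i)) \<in> E)"
    using assms(2,3)
  proof (induction k arbitrary: a rule: less_induct)
    case (less k)
    obtain w where w: "w 0 = a" "w k = a" "\<forall>i<k. (w i, w (Suc i)) \<in> E"
      using less.prems(2) by (auto simp: relpow_fun_conv)
    have walk: "(w i, w (i + n)) \<in> E ^^ n" if "i + n \<le> k" for i n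
      unfolding relpow_fun_conv using that w(3) by (intro exI[of _ "\<lambda>l. w (i + l)"]) auto
    show ?case
    proof (cases "inj_on w {..<k}")
      case True
      \<comment> \<open>A closed walk of length 1 would be a loop.\<close>
      have "k \<noteq> 1"
        using w \<open>irrefl E\<close> by (auto simp: irrefl_def)
      with less.prems(1) have "k \<ge> 3"
        by presburger
      with True w less.prems(1) show ?thesis by metis
    next
      case False
      \<comment> \<open>Taking \<open>j < k\<close> leaves out the trivial coincidence
        \<open>w k = w 0\<close>, so the piece between \<open>i\<close> and \<open>j\<close> is
        strictly shorter than the whole walk.\<close>
      then obtain i j where ij: "i < j" "j < k" "w i = w j"
        unfolding inj_on_def by (metis lessThan_iff linorder_neqE_nat)
      have inner: "(w i, w i) \<in> E ^^ (j - i)"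
        using walk[of i "j - i"] ij by simp
      have "(a, w i) \<in> E ^^ i" "(w i, a) \<in> E ^^ (k - j)"
        using walk[of 0 i] walk[of j "k - j"] ij w by auto
      then have outer: "(a, a) \<in> E ^^ (i + (k - j))"
        unfolding relpow_add by blast
      have "odd (j - i) \<or> odd (i + (k - j))"
        using less.prems(1) ij by presburger
      moreover have "j - i < k" "i + (k - j) < k"
        using ij by linarith+
      ultimately show ?thesis
        using less.IH inner outer by blast
    qed
  qed
  with that show thesis by blast
qed

text \<open>Colour a vertex by the parity of the length of some walk to a root of its component. An
  edge between vertices of equal parity would close up an odd walk through the root.\<close>

lemma two_colourable_if_no_odd_closed_walk:
  assumes "sym E" and no_odd: "\<And>a k. odd k \<Longrightarrow> (a, a) \<notin> E ^^ k"
  obtains f :: "'a \<Rightarrow> nat" where "\<And>x. f x \<in> {0, 1}" "\<And>x y. (x, y) \<in> E \<Longrightarrow> f x \<noteq> f y"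
proof -
  define root where "root x = (SOME r. (x, r) \<in> E\<^sup>*)" for x
  define len where "len x = (SOME n. (x, root x) \<in> E ^^ n)" for x
  have len: "(x, root x) \<in> E ^^ len x" for x
  proof -
    have "(x, root x) \<in> E\<^sup>*"
      unfolding root_def by (rule someI[of _ x]) simp
    then have "\<exists>n. (x, root x) \<in> E ^^ n"
      by (rule rtrancl_imp_relpow)
    then show ?thesis
      unfolding len_def by (rule someI_ex)
  qed
  have sym_pow: "(y, x) \<in> E ^^ n" if "(x, y) \<in> E ^^ n" for x y n
    using that
  proof (induction n arbitrary: y)
    case (Suc n)
    then obtain z where "(x, z) \<in> E ^^ n" "(z, y) \<in> E"
      by (auto elim: relpow_Suc_E)
    then show ?case
      using Suc.IH \<open>sym E\<close> by (meson relpow_Suc_I2 symD)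
  qed simp
  have "len x mod 2 \<noteq> len y mod 2" if xy: "(x, y) \<in> E" for x y
  proof
    assume parity: "len x mod 2 = len y mod 2"
    have yx: "(y, x) \<in> E"
      using xy \<open>sym E\<close> by (simp add: sym_def)
    \<comment> \<open>Neighbours reach the same vertices, so \<open>SOME\<close> is applied to one
      and the same predicate and picks the same root for both.\<close>
    have "(x, r) \<in> E\<^sup>* \<longleftrightarrow> (y, r) \<in> E\<^sup>*" for r
      using xy yx by (meson converse_rtrancl_into_rtrancl)
    then have "root x = root y"
      unfolding root_def by simp
    then have "(root x, y) \<in> E ^^ len y"
      using sym_pow[OF len[of y]] by simp
    then have "(root x, x) \<in> E ^^ Suc (len y)"
      using yx by (rule relpow_Suc_I)
    \<comment> \<open>The walk goes from \<open>x\<close> to the root, on to \<open>y\<close> along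
      the reversed walk, and back to \<open>x\<close> by the edge.\<close>
    with len[of x] have "(x, x) \<in> E ^^ (len x + Suc (len y))"
      unfolding relpow_add by blast
    moreover have "odd (len x + Suc (len y))"
      using parity by presburger
    ultimately show False
      using no_odd by blast
  qed
  then show thesis
    by (intro that[of "\<lambda>x. len x mod 2"]) auto
qed

lemma odd_cycle_free_imp_colour_class_bipartite:
  assumes "odd_cycle_free X c"
  obtains f :: "'a \<Rightarrow> nat" where "\<And>x. f x \<in> {0, 1}"
    "\<And>x y. \<lbrakk>x \<in> X; y \<in> X; x \<noteq> y; c {x, y} = \<alpha>\<rbrakk> \<Longrightarrow> f x \<noteq> f y"
proof -
  \<comment> \<open>Since \<open>c {x, x}\<close> may happen to be \<alpha>, loops are excluded
    explicitly.\<close>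
  define E where "E = {(x, y). x \<in> X \<and> y \<in> X \<and> x \<noteq> y \<and> c {x, y} = \<alpha>}"
  have "sym E" "irrefl E"
    by (auto simp: E_def sym_def irrefl_def insert_commute)
  have "(a, a) \<notin> E ^^ k" if "odd k" for a k
  proof
    assume "(a, a) \<in> E ^^ k"
    then obtain m w where w: "m \<ge> 3" "odd m" "inj_on w {..<m}" "w m = w 0"
        "\<forall>i<m. (w i, w (Suc i)) \<in> E"
      using odd_closed_walk_contains_odd_cycle \<open>irrefl E\<close> \<open>odd k\<close> by metis
    have "w \<in> {..<m} \<rightarrow> X"
      using w(5) by (auto simp: E_def)
    \<comment> \<open>The closing edge of the cycle is the last step of the walk, as
      \<open>w m = w 0\<close>.\<close>
    moreover have "(w (m - 1), w 0) \<in> E"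
      using w(1,4) w(5)[rule_format, of "m - 1"] by simp
    then have "\<forall>e\<in>cycle_edges m w. c e = \<alpha>"
      using w(5) by (auto simp: cycle_edges_def E_def)
    ultimately show False
      using assms w(1-3) unfolding odd_cycle_free_def by blast
  qed
  then obtain f :: "'a \<Rightarrow> nat"
    where "\<And>x. f x \<in> {0, 1}" "\<And>x y. (x, y) \<in> E \<Longrightarrow> f x \<noteq> f y"
    using two_colourable_if_no_odd_closed_walk[OF \<open>sym E\<close>] by metis
  then show thesis
    by (intro that[of f]) (auto simp: E_def)
qed

theorem proposition3p5:
  fixes \<kappa> :: "'k rel" and X :: "'a set" and c :: "'a set \<Rightarrow> 'k"
  assumes "Card_order \<kappa>"
    and "colouring X \<kappa> c"
    and "odd_cycle_free X c"
  shows "\<exists>\<iota> :: 'a \<Rightarrow> ('k \<Rightarrow> nat). \<iota> \<in> X \<rightarrow> two_power \<kappa> \<and> inj_on \<iota> X \<and>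
    (\<exists>c'. (\<forall>x\<in>X. \<forall>y\<in>X. x \<noteq> y \<longrightarrow> c' {\<iota> x, \<iota> y} = c {x, y}) \<and>
          delta_colouring \<kappa> (\<iota> ` X) c')"
proof -
  have "\<exists>f :: 'a \<Rightarrow> nat. (\<forall>x. f x \<in> {0, 1}) \<and>
      (\<forall>x\<in>X. \<forall>y\<in>X. x \<noteq> y \<longrightarrow> c {x, y} = \<alpha> \<longrightarrow> f x \<noteq> f y)" for \<alpha>
    using odd_cycle_free_imp_colour_class_bipartite[OF assms(3), of \<alpha>] by metis
  then obtain f :: "'k \<Rightarrow> 'a \<Rightarrow> nat" where f01: "\<And>\<alpha> x. f \<alpha> x \<in> {0, 1}"
    and f: "\<And>\<alpha> x y. \<lbrakk>x \<in> X; y \<in> X; x \<noteq> y; c {x, y} = \<alpha>\<rbrakk> \<Longrightarrow> f \<alpha> x \<noteq> f \<alpha> y"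
    by metis
  \<comment> \<open>The restriction makes \<open>\<iota> x\<close> extensional, as
    \<open>two_power\<close> demands; all colours of pairs lie in \<open>Field \<kappa>\<close>,
    where the values of \<open>f\<close> are kept.\<close>
  define \<iota> where "\<iota> x = restrict (\<lambda>\<alpha>. f \<alpha> x) (Field \<kappa>)" for x
  \<comment> \<open>The colouring is transported by pulling each pair back to \<open>X\<close>; this
    gives the intended values once \<iota> is known to be injective.\<close>
  define c' where "c' e = c (inv_into X \<iota> ` e)" for e
  have c_Field: "c {x, y} \<in> Field \<kappa>" if "x \<in> X" "y \<in> X" "x \<noteq> y" for x y
    using assms(2) that by (auto simp: colouring_def nsets_def Pi_iff)
  have differ: "\<iota> x (c {x, y}) \<noteq> \<iota> y (c {x, y})" if "x \<in> X" "y \<in> X" "x \<noteq> y" for x y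
    using f[OF that refl] c_Field[OF that] by (simp add: \<iota>_def)
  have inj: "inj_on \<iota> X"
    using differ by (metis inj_onI)
  have \<iota>: "\<iota> x \<in> two_power \<kappa>" for x
    using f01 by (auto simp: \<iota>_def two_power_def)
  have c': "c' {\<iota> x, \<iota> y} = c {x, y}" if "x \<in> X" "y \<in> X" for x y
    using that inj by (simp add: c'_def)
  have "colouring (\<iota> ` X) \<kappa> c'"
    unfolding colouring_def
  proof
    fix e assume "e \<in> nsets (\<iota> ` X) 2"
    then obtain x y where "e = {\<iota> x, \<iota> y}" "x \<in> X" "y \<in> X" "x \<noteq> y"
      by (fastforce simp: nsets_def card_2_iff)
    then show "c' e \<in> Field \<kappa>"
      using c' c_Field by simp
  qed
  then have "delta_colouring \<kappa> (\<iota> ` X) c'"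
    unfolding delta_colouring_def using \<iota> differ c' by auto
  with \<iota> inj c' show ?thesis
    by (intro exI[of _ \<iota>]) auto
qed

end
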